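(* For any $(X,Y)\in\mathbb{S}^n_{\succeq0}\times\mathbb{S}^n_{\succeq0}$, $$\lambda_{\max}(X,Y)=\frac{1}{\lambda_{\min}(Y,X)},$$ with the conventions $1/0=\infty$ and $1/\infty=0$.
   Context: $\mathbb{S}^n_{\succeq0}$ is the set of real symmetric positive semidefinite $n\times n$ matrices; $\mathrm{Ker}\,Y=\{v\in\mathbb{R}^n\mid Yv=0\}$. For $X,Y\in\mathbb{S}^n_{\succeq0}$, $$\lambda_{\max}(X,Y):=\begin{cases}\displaystyle\sup_{v\notin\mathrm{Ker}\,Y}\frac{v^\top Xv}{v^\top Yv} & (Y\neq0),\\ \infty & (X\neq0,\ Y=0),\\ 0 & (X=Y=0),\end{cases}\qquad \lambda_{\min}(X,Y):=\begin{cases}\displaystyle\inf_{v\notin\mathrm{Ker}\,Y}\frac{v^\top Xv}{v^\top Yv} & (Y\neq0),\\ \infty & (Y=0).\end{cases}$$ *)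

theory Defs
  imports "HOL-Analysis.Analysis"
begin

definition psd_matrices :: "(real^'n^'n) set" where
  "psd_matrices = {A. transpose A = A \<and> (\<forall>v. 0 \<le> v \<bullet> (A *v v))}"

definition matrix_ker :: "real^'n^'n \<Rightarrow> (real^'n) set" where
  "matrix_ker A = {v. A *v v = 0}"

text \<open>
  Each quotient is formed in the reals, where the denominator is nonzero because
  positive semidefinite \<open>Y\<close> satisfies \<open>v \<bullet> (Y *v v) = 0\<close> only on its kernel.
  The supremum and the infimum are taken in \<^typ>\<open>ereal\<close>, as the quotients
  may be unbounded above.
\<close>

definition lambda_max :: "real^'n^'n \<Rightarrow> real^'n^'n \<Rightarrow> ereal" where
  "lambda_max X Y =
    (if Y \<noteq> 0 then (SUP v \<in> - matrix_ker Y. ereal ((v \<bullet> (X *v v)) / (v \<bullet> (Y *v v))))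
     else if X \<noteq> 0 then \<infinity>
     else 0)"

definition lambda_min :: "real^'n^'n \<Rightarrow> real^'n^'n \<Rightarrow> ereal" where
  "lambda_min X Y =
    (if Y \<noteq> 0 then (INF v \<in> - matrix_ker Y. ereal ((v \<bullet> (X *v v)) / (v \<bullet> (Y *v v))))
     else \<infinity>)"

text \<open>
  Division on \<^typ>\<open>ereal\<close> already follows the conventions \<open>1 / 0 = \<infinity>\<close> and
  \<open>1 / \<infinity> = 0\<close>.
\<close>

lemma ereal_one_divide_conventions:
  "1 / (0::ereal) = \<infinity>" "1 / (\<infinity>::ereal) = 0"
  by (simp_all add: divide_ereal_def)

end

theory Submission
  imports Defs
begin

text \<open>
  Inversion turns the quotients of one side into those of the other, except at vectors where
  exactly one of the two forms vanishes. If \<open>v\<close> lies in \<open>Ker Y\<close> but not in \<open>Ker X\<close>, then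
  the infimum is \<open>0\<close>, and the supremum is infinite because the quotients blow up along
  \<open>t v + w\<close> for any \<open>w\<close> outside \<open>Ker Y\<close>.
\<close>

lemma psd_inner_nonneg: "A \<in> psd_matrices \<Longrightarrow> 0 \<le> v \<bullet> (A *v v)"
  by (simp add: psd_matrices_def)

lemma psd_inner_commute:
  assumes "A \<in> psd_matrices"
  shows "v \<bullet> (A *v w) = w \<bullet> (A *v v)"
proof -
  have "v \<bullet> (A *v w) = (transpose A *v v) \<bullet> w"
    by (simp only: transpose_matrix_vector dot_lmul_matrix)
  also have "transpose A = A"
    using assms by (simp add: psd_matrices_def)
  finally show ?thesis
    by (simp only: inner_commute)
qed

lemma psd_inner_combination:
  assumes "A \<in> psd_matrices"
  shows "(t *\<^sub>R v + w) \<bullet> (A *v (t *\<^sub>R v + w))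
    = t\<^sup>2 * (v \<bullet> (A *v v)) + 2 * t * (v \<bullet> (A *v w)) + w \<bullet> (A *v w)"
  using psd_inner_commute[OF assms, of w v]
  by (simp add: matrix_vector_right_distrib matrix_vector_mult_scaleR inner_add_left
      inner_add_right power2_eq_square algebra_simps)

text \<open>If the form vanishes at \<open>v\<close> but \<open>A *v v\<close> is nonzero, a small
  step from \<open>v\<close> against \<open>A *v v\<close> makes the form negative.\<close>

lemma psd_inner_eq_0_iff:
  assumes "A \<in> psd_matrices"
  shows "v \<bullet> (A *v v) = 0 \<longleftrightarrow> v \<in> matrix_ker A"
proof
  assume 0: "v \<bullet> (A *v v) = 0"
  define c d where "c = (A *v v) \<bullet> (A *v v)" and "d = (A *v v) \<bullet> (A *v (A *v v))"
  have d: "0 \<le> d"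
    unfolding d_def by (rule psd_inner_nonneg[OF assms])
  \<comment> \<open>The step length minimizing \<open>k\<^sup>2 * d - 2 * k * c\<close> is
    \<open>c / d\<close>; the added 1 covers \<open>d = 0\<close> and still leaves a negative value
    unless \<open>k = 0\<close>.\<close>
  define k where "k = c / (d + 1)"
  with d have c: "c = k * (d + 1)"
    by simp
  have "0 \<le> (- k *\<^sub>R (A *v v) + v) \<bullet> (A *v (- k *\<^sub>R (A *v v) + v))"
    by (rule psd_inner_nonneg[OF assms])
  also have "\<dots> = k\<^sup>2 * d - 2 * k * c"
    unfolding psd_inner_combination[OF assms] using 0
    by (simp add: c_def d_def inner_commute psd_inner_commute[OF assms])
  also have "\<dots> = - (k\<^sup>2 * (d + 2))"
    by (simp add: c algebra_simps power2_eq_square)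
  finally have "k\<^sup>2 * (d + 2) \<le> 0"
    by simp
  with d have "k = 0"
    by (simp add: mult_le_0_iff)
  with c show "v \<in> matrix_ker A"
    by (simp add: c_def matrix_ker_def)
qed (simp add: matrix_ker_def)

lemma psd_inner_pos_iff:
  assumes "A \<in> psd_matrices"
  shows "0 < v \<bullet> (A *v v) \<longleftrightarrow> v \<notin> matrix_ker A"
  using psd_inner_nonneg[OF assms, of v] psd_inner_eq_0_iff[OF assms, of v] by linarith

lemma matrix_ker_neq_UNIV: "A \<noteq> 0 \<Longrightarrow> - matrix_ker A \<noteq> {}"
  by (auto simp: matrix_ker_def matrix_eq)

text \<open>Inversion jumps from negative to positive values at 0, hence the restriction to
  nonnegative arguments.\<close>

lemma ereal_one_divide_antimono:
  "0 \<le> x \<Longrightarrow> x \<le> y \<Longrightarrow> 1 / y \<le> 1 / (x :: ereal)"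
  by (simp add: divide_ereal_def ereal_inverse_antimono)

lemma ereal_one_divide_one_divide: "0 \<le> x \<Longrightarrow> 1 / (1 / (x :: ereal)) = x"
  by (cases x) (auto simp: divide_ereal_def one_ereal_def)

lemma lambda_max_nonneg:
  assumes "X \<in> psd_matrices" and "Y \<in> psd_matrices"
  shows "0 \<le> lambda_max X Y"
proof (cases "Y = 0")
  case False
  then obtain w where "w \<notin> matrix_ker Y"
    using matrix_ker_neq_UNIV by blast
  with False show ?thesis
    by (auto simp: lambda_max_def psd_inner_nonneg assms intro!: SUP_upper2)
qed (simp add: lambda_max_def)

lemma lambda_min_nonneg:
  assumes "X \<in> psd_matrices" and "Y \<in> psd_matrices"
  shows "0 \<le> lambda_min X Y"
  by (auto simp: lambda_min_def psd_inner_nonneg assms intro!: INF_greatest)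

lemma lambda_max_eq_PInfty:
  assumes X: "X \<in> psd_matrices" and Y: "Y \<in> psd_matrices"
    and vX: "v \<notin> matrix_ker X" and vY: "v \<in> matrix_ker Y"
  shows "lambda_max X Y = \<infinity>"
proof (cases "Y = 0")
  case True
  with vX show ?thesis
    by (auto simp: lambda_max_def matrix_ker_def)
next
  case False
  then obtain w' where w': "w' \<notin> matrix_ker Y"
    using matrix_ker_neq_UNIV by blast
  text \<open>The sign of \<open>w\<close> is chosen so that the cross term of the form of \<open>X\<close> is nonnegative.\<close>
  obtain w where w: "w \<notin> matrix_ker Y" and vw: "0 \<le> v \<bullet> (X *v w)"
  proof (cases "0 \<le> v \<bullet> (X *v w')")
    case False
    then show ?thesis
      using w' by (intro that[of "- w'"])
        (auto simp: matrix_ker_def linear_neg[OF matrix_vector_mul_linear])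
  qed (use w' that in blast)
  have a: "0 < v \<bullet> (X *v v)" and b: "0 < w \<bullet> (Y *v w)"
    using vX w by (simp_all add: psd_inner_pos_iff X Y)
  have "\<exists>u \<in> - matrix_ker Y. ereal (real n) \<le> ereal ((u \<bullet> (X *v u)) / (u \<bullet> (Y *v u)))" for n
  proof -
    \<comment> \<open>Chosen so that the quadratic term of the numerator alone is \<open>n\<close>
      times the denominator, which stays at \<open>w \<bullet> (Y *v w)\<close>.\<close>
    define t where "t = sqrt (real n * (w \<bullet> (Y *v w)) / (v \<bullet> (X *v v)))"
    have t: "0 \<le> t" and t2: "t\<^sup>2 * (v \<bullet> (X *v v)) = real n * (w \<bullet> (Y *v w))"
      using a b by (simp_all add: t_def)
    define u where "u = t *\<^sub>R v + w"
    \<comment> \<open>Symmetry moves \<open>Y\<close> onto \<open>v\<close>, where it vanishes, so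
      adding \<open>t *\<^sub>R v\<close> leaves the form of \<open>Y\<close> unchanged.\<close>
    have "v \<bullet> (Y *v w) = 0"
      using vY psd_inner_commute[OF Y, of v w] by (simp add: matrix_ker_def)
    then have uY: "u \<bullet> (Y *v u) = w \<bullet> (Y *v w)"
      using vY by (simp add: u_def psd_inner_combination[OF Y] matrix_ker_def)
    have "real n * (w \<bullet> (Y *v w)) \<le> u \<bullet> (X *v u)"
      using t vw by (simp add: u_def psd_inner_combination[OF X] t2 psd_inner_nonneg[OF X])
    with b have "real n \<le> (u \<bullet> (X *v u)) / (u \<bullet> (Y *v u))"
      by (simp add: uY field_simps)
    moreover have "u \<notin> matrix_ker Y"
      using b by (simp add: uY flip: psd_inner_pos_iff[OF Y])
    ultimately show ?thesis
      by auto
  qed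
  with False show ?thesis
    unfolding lambda_max_def by (simp add: SUP_PInfty)
qed

theorem proposition17:
  fixes X Y :: "real^'n^'n"
  assumes "X \<in> psd_matrices" and "Y \<in> psd_matrices"
  shows "lambda_max X Y = 1 / lambda_min Y X"
proof (cases "X = 0 \<or> Y = 0")
  case True
  then show ?thesis
    \<comment> \<open>When exactly one matrix is zero, the remaining supremum or infimum is of the
      constant 0, over an index set that must be nonempty for the value to be 0.\<close>
    using matrix_ker_neq_UNIV[of X] matrix_ker_neq_UNIV[of Y]
    by (auto simp: lambda_max_def lambda_min_def ereal_one_divide_conventions
        simp flip: zero_ereal_def)
next
  case False
  note nonneg = psd_inner_nonneg[OF assms(1)] psd_inner_nonneg[OF assms(2)]
  show ?thesis
  proof (rule antisym)
    have "ereal ((v \<bullet> (X *v v)) / (v \<bullet> (Y *v v))) \<le> 1 / lambda_min Y X"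
      if v: "v \<notin> matrix_ker Y" for v
    proof (cases "v \<in> matrix_ker X")
      case True
      then show ?thesis
        \<comment> \<open>The quotient is 0 here; comparing \<open>lambda_min Y X\<close> with
          \<infinity> gives \<open>0 = 1 / \<infinity> \<le> 1 / lambda_min Y X\<close>.\<close>
        using ereal_one_divide_antimono[OF lambda_min_nonneg[OF assms(2,1)], of \<infinity>]
        by (simp add: matrix_ker_def ereal_one_divide_conventions flip: zero_ereal_def)
    next
      case vX: False
      then have "lambda_min Y X \<le> ereal ((v \<bullet> (Y *v v)) / (v \<bullet> (X *v v)))"
        using False by (auto simp: lambda_min_def intro: INF_lower)
      then have "1 / ereal ((v \<bullet> (Y *v v)) / (v \<bullet> (X *v v))) \<le> 1 / lambda_min Y X"
        by (intro ereal_one_divide_antimono lambda_min_nonneg assms)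
      then show ?thesis
        using v by (simp add: one_ereal_def psd_inner_eq_0_iff assms vX)
    qed
    then show "lambda_max X Y \<le> 1 / lambda_min Y X"
      using False by (auto simp: lambda_max_def intro!: SUP_least)
  next
    \<comment> \<open>In inverted form the claim is a lower bound on every quotient, hence on their
      infimum; a second inversion then undoes the first.\<close>
    have "1 / lambda_max X Y \<le> ereal ((v \<bullet> (Y *v v)) / (v \<bullet> (X *v v)))"
      if v: "v \<notin> matrix_ker X" for v
    proof (cases "v \<in> matrix_ker Y")
      case True
      then show ?thesis
        \<comment> \<open>The right side is 0 here, so the bound depends on the left side being
          \<open>1 / \<infinity> = 0\<close>.\<close>
        using lambda_max_eq_PInfty[OF assms v True] by (simp add: nonneg)
    next
      case vY: False
      then have "ereal ((v \<bullet> (X *v v)) / (v \<bullet> (Y *v v))) \<le> lambda_max X Y"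
        using False by (auto simp: lambda_max_def intro: SUP_upper)
      then have "1 / lambda_max X Y \<le> 1 / ereal ((v \<bullet> (X *v v)) / (v \<bullet> (Y *v v)))"
        by (intro ereal_one_divide_antimono) (simp_all add: nonneg)
      then show ?thesis
        using v by (simp add: one_ereal_def psd_inner_eq_0_iff assms vY)
    qed
    then have "1 / lambda_max X Y \<le> lambda_min Y X"
      using False by (auto simp: lambda_min_def intro!: INF_greatest)
    then have "1 / lambda_min Y X \<le> 1 / (1 / lambda_max X Y)"
      by (intro ereal_one_divide_antimono) (simp_all add: lambda_max_nonneg assms)
    then show "1 / lambda_min Y X \<le> lambda_max X Y"
      by (simp add: ereal_one_divide_one_divide lambda_max_nonneg assms)
  qed
qed

end
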